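(* Let $\mathbb{T}$ be a time scale, let $\alpha,\beta\in\mathbb{T}$ with $\alpha<\beta$, let $\psi,\phi:[\alpha,\beta]_{\mathbb{T}}\to\mathbb{R}$ be Delta-integrable functions with $\phi>0$, and let $T:[\alpha,\beta]_{\mathbb{T}}\to[0,\infty)$ be Delta-differentiable and decreasing. If $\psi/\phi$ is increasing (respectively, decreasing) on $[\alpha,\beta]_{\mathbb{T}}$ and $\psi(\alpha)/\phi(\alpha)\ge 1$ (respectively, $\psi(\alpha)/\phi(\alpha)\le 1$), then the function $$s\mapsto \frac{T(s)+\int_{\alpha}^s \psi(\upsilon)\,\Delta\upsilon}{T(s)+\int_{\alpha}^s \phi(\upsilon)\,\Delta\upsilon}$$ is increasing (respectively, decreasing) on $[\alpha,\beta]_{\mathbb{T}}$.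
   Context: A time scale $\mathbb{T}$ is a nonempty closed subset of $\mathbb{R}$, and $[\alpha,\beta]_{\mathbb{T}}=[\alpha,\beta]\cap\mathbb{T}$. The forward jump operator is $\sigma(t)=\inf\{r\in\mathbb{T}: r>t\}$. A function $f$ is Delta-differentiable at $t$ with derivative $f^\Delta(t)$ if for every $\varepsilon>0$ there is a neighbourhood $U$ of $t$ with $|f(\sigma(t))-f(r)-f^\Delta(t)(\sigma(t)-r)|\le\varepsilon|\sigma(t)-r|$ for all $r\in U\cap\mathbb{T}$ (not required at the right endpoint $\beta$ if $\beta$ is left-scattered). The Delta integral $\int_a^b f(\upsilon)\,\Delta\upsilon$ ($a\le b$ in $\mathbb{T}$) is the standard one, i.e. the integral of $f$ over $[a,b)\cap\mathbb{T}$ with respect to the Delta measure $\mu_\Delta$ on $\mathbb{T}$, determined by $\mu_\Delta([c,d)\cap\mathbb{T})=d-c$ for $c\le d$ in $\mathbb{T}$. "Increasing" and "decreasing" are meant in the non-strict sense.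
   Formalization: If T(α)=0, the quotient at s=α is 0/0 and undefined; monotonicity is therefore asserted at the points of [α,β]_𝕋 where the denominator is nonzero, that is, everywhere except s=α in the case T(α)=0. *)

theory Defs
  imports "HOL-Analysis.Analysis"
begin

definition time_scale :: "real set \<Rightarrow> bool" where
  "time_scale S \<longleftrightarrow> S \<noteq> {} \<and> closed S"

text \<open>The jump operators follow the usual conventions \<open>inf {} = sup S\<close> and \<open>sup {} = inf S\<close>,
  which are not the ones of the type \<open>real\<close>; so \<open>\<sigma>(max S) = max S\<close> and \<open>\<rho>(min S) = min S\<close>.\<close>

definition forward_jump :: "real set \<Rightarrow> real \<Rightarrow> real" where
  "forward_jump S t = (if {r \<in> S. r > t} = {} then Sup S else Inf {r \<in> S. r > t})"

definition backward_jump :: "real set \<Rightarrow> real \<Rightarrow> real" where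
  "backward_jump S t = (if {r \<in> S. r < t} = {} then Inf S else Sup {r \<in> S. r < t})"

definition left_scattered :: "real set \<Rightarrow> real \<Rightarrow> bool" where
  "left_scattered S t \<longleftrightarrow> backward_jump S t < t"

definition has_delta_derivative :: "real set \<Rightarrow> (real \<Rightarrow> real) \<Rightarrow> real \<Rightarrow> real \<Rightarrow> bool" where
  "has_delta_derivative S f D t \<longleftrightarrow>
     (\<forall>\<epsilon>>0. \<exists>U. open U \<and> t \<in> U \<and>
        (\<forall>r\<in>U \<inter> S. \<bar>f (forward_jump S t) - f r - D * (forward_jump S t - r)\<bar>
                      \<le> \<epsilon> * \<bar>forward_jump S t - r\<bar>))"

text \<open>A function on \<open>[a,b]\<close> in a time scale is differentiated with respect to the time scale
  \<open>S = {a..b} \<inter> \<T>\<close> on which it is defined. A left-scattered maximum of \<open>S\<close> is exempt.\<close>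

definition delta_differentiable :: "real set \<Rightarrow> (real \<Rightarrow> real) \<Rightarrow> bool" where
  "delta_differentiable S f \<longleftrightarrow>
     (\<forall>t\<in>S. \<not> ((\<forall>r\<in>S. r \<le> t) \<and> left_scattered S t) \<longrightarrow> (\<exists>D. has_delta_derivative S f D t))"

text \<open>The Delta measure without the null sets added. The intervals determine it except for
  the mass of a possible maximum of \<open>S\<close>, which lies in no \<open>[c,d)\<close> with \<open>d \<in> S\<close>.\<close>

definition delta_premeasure :: "real set \<Rightarrow> real measure" where
  "delta_premeasure S =
     extend_measure S {(c, d). c \<in> S \<and> d \<in> S \<and> c \<le> d}
       (\<lambda>(c, d). {c..<d} \<inter> S) (\<lambda>(c, d). ennreal (d - c))"

lemma emeasure_delta_premeasure:
  assumes S: "time_scale S" and cd: "c \<in> S" "d \<in> S" "c \<le> d"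
  shows "emeasure (delta_premeasure S) ({c..<d} \<inter> S) = ennreal (d - c)"
proof -
  let ?G = "{{c..<d} \<inter> S |c d. c \<in> S \<and> d \<in> S \<and> c \<le> d}"
  define A where "A = {t. (\<exists>c\<in>S. c \<le> t) \<and> (\<exists>d\<in>S. t < d)}"
  define g where "g t = Sup {r \<in> S. r \<le> t}" for t
  have g: "g t \<in> S" "g t \<le> t" "\<And>r. r \<in> S \<Longrightarrow> r \<le> t \<Longrightarrow> r \<le> g t" if t: "t \<in> A" for t
  proof -
    have ne: "{r \<in> S. r \<le> t} \<noteq> {}" and bdd: "bdd_above {r \<in> S. r \<le> t}"
      using t by (auto simp: A_def bdd_above_def)
    have "{r \<in> S. r \<le> t} = S \<inter> {..t}"
      by auto
    then have "closed {r \<in> S. r \<le> t}"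
      using S by (auto simp: time_scale_def)
    then have "g t \<in> {r \<in> S. r \<le> t}"
      unfolding g_def by (intro closed_contains_Sup ne bdd)
    then show "g t \<in> S" "g t \<le> t"
      by auto
    show "r \<le> g t" if "r \<in> S" "r \<le> t" for r
      unfolding g_def using that by (intro cSup_upper bdd) auto
  qed
  have pre: "g -` ({c..<d} \<inter> S) \<inter> A = {c..<d}" if "c \<in> S" "d \<in> S" for c d
  proof (intro equalityI subsetI)
    fix t assume "t \<in> g -` ({c..<d} \<inter> S) \<inter> A"
    then show "t \<in> {c..<d}"
      using g[of t] that(2) by fastforce
  next
    fix t assume t: "t \<in> {c..<d}"
    then have "t \<in> A"
      using that by (auto simp: A_def)
    then show "t \<in> g -` ({c..<d} \<inter> S) \<inter> A"
      using g[of t] t that by fastforce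
  qed
  have "is_interval A"
    unfolding is_interval_1 A_def by (auto intro: order_trans le_less_trans)
  then have A: "A \<in> sets borel"
    by (metis (full_types) is_real_interval atLeastAtMost_borel atLeastLessThan_borel atLeast_borel
        atMost_borel greaterThanAtMost_borel greaterThanLessThan_borel greaterThan_borel
        lessThan_borel sets.empty_sets sets.top space_borel)
  let ?R = "restrict_space lborel A"
  have sets_G: "sets (sigma S ?G) = sigma_sets S ?G"
    by (intro sets_measure_of) auto
  have R: "g \<in> measurable ?R (sigma S ?G)"
  proof (rule measurable_sigma_sets[where \<Omega> = S and A = ?G])
    show "sets (sigma S ?G) = sigma_sets S ?G"
      by (fact sets_G)
    show "?G \<subseteq> Pow S"
      by auto
    show "g \<in> space ?R \<rightarrow> S"
      using g by (auto simp: space_restrict_space)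
    fix y assume "y \<in> ?G"
    then obtain c d where y: "y = {c..<d} \<inter> S" and "c \<in> S" "d \<in> S"
      by auto
    then have "g -` y \<inter> space ?R = {c..<d}"
      using pre by (simp add: space_restrict_space)
    moreover have "{c..<d} \<subseteq> A"
      using pre[OF \<open>c \<in> S\<close> \<open>d \<in> S\<close>] by auto
    ultimately show "g -` y \<inter> space ?R \<in> sets ?R"
      using A by (simp add: sets_restrict_space_iff)
  qed
  let ?M = "distr ?R (sigma S ?G) g"
  have G_eq: "(\<lambda>(c, d). {c..<d} \<inter> S) ` {(c, d). c \<in> S \<and> d \<in> S \<and> c \<le> d} = ?G"
    by auto
  have sets: "sets (delta_premeasure S) = sets ?M"
    unfolding delta_premeasure_def
    using sets_extend_measure[of "\<lambda>(c, d). {c..<d} \<inter> S" "{(c, d). c \<in> S \<and> d \<in> S \<and> c \<le> d}" S]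
    unfolding G_eq sets_distr sets_G by blast
  show ?thesis
  proof (rule emeasure_extend_measure_Pair[OF delta_premeasure_def, where \<mu>' = "emeasure ?M"])
    show "c \<in> S \<and> d \<in> S \<and> c \<le> d"
      using cd by simp
    show "{i..<j} \<inter> S \<in> Pow S" for i j
      by auto
    show "positive (sets (delta_premeasure S)) (emeasure ?M)"
      unfolding sets by (rule emeasure_positive)
    show "countably_additive (sets (delta_premeasure S)) (emeasure ?M)"
      unfolding sets by (rule emeasure_countably_additive)
    fix i j assume ij: "i \<in> S \<and> j \<in> S \<and> i \<le> j"
    have "{i..<j} \<inter> S \<in> ?G"
      using ij by auto
    then have in_sets: "{i..<j} \<inter> S \<in> sets (sigma S ?G)"
      unfolding sets_G by (rule sigma_sets.Basic)
    have "{i..<j} \<subseteq> A"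
      using pre[of i j] ij by auto
    with ij show "emeasure ?M ({i..<j} \<inter> S) = ennreal (j - i)"
      using A by (simp add: emeasure_distr[OF R in_sets] pre space_restrict_space emeasure_restrict_space
          del: vimage_Int)
  qed
qed

definition delta_measure :: "real set \<Rightarrow> real measure" where
  "delta_measure S = completion (delta_premeasure S)"

definition delta_integrable :: "real set \<Rightarrow> real \<Rightarrow> real \<Rightarrow> (real \<Rightarrow> real) \<Rightarrow> bool" where
  "delta_integrable S a b f \<longleftrightarrow> set_integrable (delta_measure S) ({a..<b} \<inter> S) f"

definition delta_integral :: "real set \<Rightarrow> real \<Rightarrow> real \<Rightarrow> (real \<Rightarrow> real) \<Rightarrow> real" where
  "delta_integral S a b f = set_lebesgue_integral (delta_measure S) ({a..<b} \<inter> S) f"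

end

theory Submission
  imports Defs
begin

text \<open>For \<open>s < s'\<close> put \<open>c = \<psi> s / \<phi> s\<close> and let \<open>R\<close> be the quotient at \<open>s\<close>. Monotonicity of
  \<open>\<psi> / \<phi>\<close> gives \<open>\<psi> \<le> c \<phi>\<close> before \<open>s\<close> and \<open>\<psi> \<ge> c \<phi>\<close> after it, and the initial condition gives
  \<open>\<psi> \<ge> \<phi>\<close>; hence \<open>1 \<le> R \<le> c\<close>. Passing from \<open>s\<close> to \<open>s'\<close> adds integrals whose ratio is at least
  \<open>c \<ge> R\<close> and lowers numerator and denominator by the same amount, and neither lets
  a quotient \<open>R \<ge> 1\<close> drop. The decreasing case follows by replacing \<open>\<psi>\<close> by \<open>2 \<phi> - \<psi>\<close>, which
  turns the quotient \<open>R\<close> into \<open>2 - R\<close>.\<close>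

text \<open>Half-open intervals with endpoints in \<open>S\<close> generate the sigma-algebra, and
  completion only enlarges it.\<close>

lemma sets_delta_measure_atLeastLessThan:
  assumes "c \<in> S" "d \<in> S" "c \<le> d"
  shows "{c..<d} \<inter> S \<in> sets (delta_measure S)"
proof -
  have "{c..<d} \<inter> S \<in> sets (delta_premeasure S)"
    unfolding delta_premeasure_def
    using assms by (subst sets_extend_measure) (auto intro!: sigma_sets.Basic)
  then show ?thesis
    unfolding delta_measure_def by (rule sets_completionI_sets)
qed

lemma delta_integrable_subinterval:
  assumes "delta_integrable S a b f" "c \<in> S" "d \<in> S" "a \<le> c" "c \<le> d" "d \<le> b"
  shows "delta_integrable S c d f"
  using assms unfolding delta_integrable_def
  by (elim set_integrable_subset) (auto intro: sets_delta_measure_atLeastLessThan)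

text \<open>Half-open pieces are disjoint, so a point mass at \<open>b\<close> is counted once, in
  the right piece.\<close>

lemma delta_integral_combine:
  assumes "delta_integrable S a c f" "a \<in> S" "b \<in> S" "c \<in> S" "a \<le> b" "b \<le> c"
  shows "delta_integral S a c f = delta_integral S a b f + delta_integral S b c f"
proof -
  have "delta_integrable S a b f" "delta_integrable S b c f"
    using assms by (auto intro: delta_integrable_subinterval)
  moreover have "{a..<c} \<inter> S = ({a..<b} \<inter> S) \<union> ({b..<c} \<inter> S)"
    using assms by auto
  moreover have "({a..<b} \<inter> S) \<inter> ({b..<c} \<inter> S) = {}"
    by auto
  ultimately show ?thesis
    unfolding delta_integral_def delta_integrable_def by (simp add: set_integral_Un)
qed

lemma delta_integral_mono:
  assumes "delta_integrable S a b f" "delta_integrable S a b g"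
    and "\<And>t. t \<in> S \<Longrightarrow> a \<le> t \<Longrightarrow> t < b \<Longrightarrow> f t \<le> g t"
  shows "delta_integral S a b f \<le> delta_integral S a b g"
  using assms unfolding delta_integral_def delta_integrable_def
  by (intro set_integral_mono) auto

lemma delta_integrable_scaled:
  assumes "delta_integrable S a b f"
  shows "delta_integrable S a b (\<lambda>t. k * f t)"
  using assms unfolding delta_integrable_def by simp

lemma delta_integral_scaled:
  "delta_integral S a b (\<lambda>t. k * f t) = k * delta_integral S a b f"
  unfolding delta_integral_def by simp

text \<open>A non-integrable \<open>f\<close> is covered too: its integral is 0 by default.\<close>

lemma delta_integral_nonneg:
  assumes "\<And>t. t \<in> S \<Longrightarrow> a \<le> t \<Longrightarrow> t < b \<Longrightarrow> 0 \<le> f t"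
  shows "0 \<le> delta_integral S a b f"
  using assms unfolding delta_integral_def set_lebesgue_integral_def
  by (intro Bochner_Integration.integral_nonneg) (auto simp: indicator_def)

text \<open>The arithmetic of passing from \<open>s\<close> to \<open>s'\<close>: \<open>P\<close>
  and \<open>Q\<close> are the integrals up to \<open>s\<close>, \<open>p\<close> and
  \<open>q\<close> those from \<open>s\<close> to \<open>s'\<close>, \<open>T\<close> and
  \<open>T'\<close> the values of the decreasing function, \<open>c\<close> the ratio of the
  integrands at \<open>s\<close>.\<close>

lemma quotient_step_mono:
  fixes T T' P Q p q c :: real
  assumes "0 \<le> T" "T' \<le> T" "1 \<le> c" "Q \<le> P" "P \<le> c * Q" "c * q \<le> p" "0 \<le> q"
    and "0 < T + Q" "0 < T' + (Q + q)"
  shows "(T + P) / (T + Q) \<le> (T' + (P + p)) / (T' + (Q + q))"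
proof -
  define R where "R = (T + P) / (T + Q)"
  have eq: "T + P = R * (T + Q)"
    using assms by (simp add: R_def)
  have "1 \<le> R"
    using assms by (simp add: R_def)
  \<comment> \<open>Since \<open>c\<close> is at least 1, the bound \<open>P \<le> c * Q\<close>
    survives adding \<open>T\<close> to both integrals.\<close>
  have "1 * T \<le> c * T"
    using assms by (intro mult_right_mono) auto
  then have "T + P \<le> c * (T + Q)"
    using assms by (simp add: distrib_left)
  then have "R \<le> c"
    using assms by (simp add: R_def divide_le_eq)
  then have "R * q \<le> p"
    using assms by (meson mult_right_mono order_trans)
  moreover have "0 \<le> (R - 1) * (T - T')"
    using assms \<open>1 \<le> R\<close> by simp
  \<comment> \<open>By \<open>eq\<close>, the right side minus the left is
    \<open>(p - R * q) + (R - 1) * (T - T')\<close>.\<close>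
  ultimately have "R * (T' + (Q + q)) \<le> T' + (P + p)"
    using eq by (simp add: algebra_simps)
  then show ?thesis
    using assms by (simp add: R_def[symmetric] le_divide_eq)
qed

text \<open>The domain leaves out zeros of the denominator, where HOL would give the quotient the
  value 0. In a time scale only \<open>s = a\<close> with \<open>T a = 0\<close> can be such a zero,
  as \<open>g\<close> is positive and [a,s) has measure s - a.\<close>

lemma delta_integral_quotient_mono:
  fixes S :: "real set" and a b :: real and f g T :: "real \<Rightarrow> real"
  assumes "a \<in> S" "b \<in> S"
    and f: "delta_integrable S a b f" and g: "delta_integrable S a b g"
    and pos: "\<forall>t\<in>{a..b} \<inter> S. g t > 0"
    and T: "\<forall>t\<in>{a..b} \<inter> S. T t \<ge> 0" "antimono_on ({a..b} \<inter> S) T"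
    and mono: "mono_on ({a..b} \<inter> S) (\<lambda>t. f t / g t)" and ge1: "f a / g a \<ge> 1"
  shows "mono_on {s \<in> {a..b} \<inter> S. T s + delta_integral S a s g \<noteq> 0}
           (\<lambda>s. (T s + delta_integral S a s f) / (T s + delta_integral S a s g))"
proof (rule mono_onI)
  let ?D = "{s \<in> {a..b} \<inter> S. T s + delta_integral S a s g \<noteq> 0}"
  fix s s' assume s: "s \<in> ?D" and s': "s' \<in> ?D" and le: "s \<le> s'"
  have int: "delta_integrable S c d f" "delta_integrable S c d g"
    if "c \<in> S" "d \<in> S" "a \<le> c" "c \<le> d" "d \<le> b" for c d
    using f g that by (auto intro: delta_integrable_subinterval)
  have nonneg: "0 \<le> delta_integral S c d g" if "a \<le> c" "d \<le> b" for c d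
    using pos that by (intro delta_integral_nonneg) (simp add: less_imp_le)
  \<comment> \<open>Both summands are nonnegative, so on \<open>?D\<close> nonzero means
    positive.\<close>
  have den: "0 < T r + delta_integral S a r g" if "r \<in> ?D" for r
  proof -
    have "0 \<le> T r" "0 \<le> delta_integral S a r g"
      using T(1) that by (auto intro: nonneg)
    then show ?thesis
      using that by auto
  qed
  define c where "c = f s / g s"
  have ratio: "f t / g t \<le> f u / g u" if "t \<in> S" "u \<in> S" "a \<le> t" "t \<le> u" "u \<le> b" for t u
    using mono that by (simp add: monotone_on_def)
  have ratio_ge1: "1 \<le> f t / g t" if "t \<in> S" "a \<le> t" "t \<le> b" for t
    using ratio[of a t] that \<open>a \<in> S\<close> ge1 by linarith
  then have "1 \<le> c"
    using s by (simp add: c_def)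
  have ge: "g t \<le> f t" if "t \<in> S" "a \<le> t" "t \<le> b" for t
    using ratio_ge1[OF that] that pos by (auto simp: pos_le_divide_eq simp del: le_divide_eq_1)
  have below: "f t \<le> c * g t" if "t \<in> S" "a \<le> t" "t \<le> s" for t
    using ratio[of t s] that s pos by (auto simp: c_def pos_divide_le_eq)
  have above: "c * g t \<le> f t" if "t \<in> S" "s \<le> t" "t \<le> b" for t
    using ratio[of s t] that s pos by (auto simp: c_def pos_le_divide_eq)
  \<comment> \<open>Integrating \<open>ge\<close> and \<open>below\<close> over [a,s) and
    \<open>above\<close> over [s,s') yields the hypotheses of
    \<open>quotient_step_mono\<close>.\<close>
  have "delta_integral S a s g \<le> delta_integral S a s f"
    using s assms by (intro delta_integral_mono int ge) auto
  moreover have "delta_integral S a s f \<le> c * delta_integral S a s g"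
    unfolding delta_integral_scaled[symmetric] using s assms
    by (intro delta_integral_mono delta_integrable_scaled int below) auto
  moreover have "c * delta_integral S s s' g \<le> delta_integral S s s' f"
    unfolding delta_integral_scaled[symmetric] using s s' le
    by (intro delta_integral_mono delta_integrable_scaled int above) auto
  moreover have "delta_integral S a s' f = delta_integral S a s f + delta_integral S s s' f"
    "delta_integral S a s' g = delta_integral S a s g + delta_integral S s s' g"
    using s s' le assms by (auto intro!: delta_integral_combine int)
  moreover have "0 \<le> T s" "T s' \<le> T s"
    using s s' le T by (simp_all add: monotone_on_def)
  moreover have "0 \<le> delta_integral S s s' g"
    using s s' by (intro nonneg) auto
  ultimately show "(T s + delta_integral S a s f) / (T s + delta_integral S a s g)
      \<le> (T s' + delta_integral S a s' f) / (T s' + delta_integral S a s' g)"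
    using quotient_step_mono \<open>1 \<le> c\<close> den[OF s] den[OF s'] by simp
qed

lemma delta_integral_quotient_antimono:
  fixes S :: "real set" and a b :: real and f g T :: "real \<Rightarrow> real"
  assumes ab: "a \<in> S" "b \<in> S" "a \<le> b"
    and f: "delta_integrable S a b f" and g: "delta_integrable S a b g"
    and pos: "\<forall>t\<in>{a..b} \<inter> S. g t > 0"
    and T: "\<forall>t\<in>{a..b} \<inter> S. T t \<ge> 0" "antimono_on ({a..b} \<inter> S) T"
    and anti: "antimono_on ({a..b} \<inter> S) (\<lambda>t. f t / g t)" and le1: "f a / g a \<le> 1"
  shows "antimono_on {s \<in> {a..b} \<inter> S. T s + delta_integral S a s g \<noteq> 0}
           (\<lambda>s. (T s + delta_integral S a s f) / (T s + delta_integral S a s g))"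
proof -
  let ?D = "{s \<in> {a..b} \<inter> S. T s + delta_integral S a s g \<noteq> 0}"
  \<comment> \<open>This reflects the ratio \<open>f t / g t\<close> about 1: the order is reversed,
    and the bound by 1 at \<open>a\<close> changes sides.\<close>
  let ?h = "\<lambda>t. 2 * g t - f t"
  have ratio: "?h t / g t = 2 - f t / g t" if "t \<in> {a..b} \<inter> S" for t
    using pos that by (force simp: diff_divide_distrib)
  have "delta_integrable S a b ?h"
    using f g unfolding delta_integrable_def by (intro set_integral_diff) auto
  moreover have "mono_on ({a..b} \<inter> S) (\<lambda>t. ?h t / g t)"
    using anti by (auto simp: monotone_on_def ratio)
  moreover have "?h a / g a \<ge> 1"
    using ratio[of a] ab le1 by simp
  ultimately have "mono_on ?D (\<lambda>s. (T s + delta_integral S a s ?h) / (T s + delta_integral S a s g))"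
    using ab g pos T by (intro delta_integral_quotient_mono) auto
  \<comment> \<open>With F and G the integrals of \<open>f\<close> and \<open>g\<close>, 2(T + G) -
    (T + F) = T + (2G - F), so \<open>T\<close> keeps its place under the reflection. Dividing by T
    + G is allowed on \<open>?D\<close>.\<close>
  moreover have "(T s + delta_integral S a s ?h) / (T s + delta_integral S a s g)
      = 2 - (T s + delta_integral S a s f) / (T s + delta_integral S a s g)" if "s \<in> ?D" for s
  proof -
    have "delta_integrable S a s f" "delta_integrable S a s g"
      using f g that ab by (auto intro: delta_integrable_subinterval)
    then have "delta_integral S a s ?h = 2 * delta_integral S a s g - delta_integral S a s f"
      unfolding delta_integrable_def delta_integral_def by (simp add: set_integral_diff)
    then show ?thesis
      using that by (simp add: field_simps)
  qed
  ultimately show ?thesis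
    by (simp add: monotone_on_def)
qed

theorem theorem2p2:
  fixes \<T> :: "real set" and \<alpha> \<beta> :: real and \<psi> \<phi> T :: "real \<Rightarrow> real"
  assumes "time_scale \<T>"
    and "\<alpha> \<in> \<T>" and "\<beta> \<in> \<T>" and "\<alpha> < \<beta>"
    and "delta_integrable \<T> \<alpha> \<beta> \<psi>" and "delta_integrable \<T> \<alpha> \<beta> \<phi>"
    and "\<forall>t\<in>{\<alpha>..\<beta>} \<inter> \<T>. \<phi> t > 0"
    and "\<forall>t\<in>{\<alpha>..\<beta>} \<inter> \<T>. T t \<ge> 0"
    and "delta_differentiable ({\<alpha>..\<beta>} \<inter> \<T>) T"
    and "antimono_on ({\<alpha>..\<beta>} \<inter> \<T>) T"
  shows "(mono_on ({\<alpha>..\<beta>} \<inter> \<T>) (\<lambda>t. \<psi> t / \<phi> t) \<and> \<psi> \<alpha> / \<phi> \<alpha> \<ge> 1 \<longrightarrow>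
           mono_on {s \<in> {\<alpha>..\<beta>} \<inter> \<T>. T s + delta_integral \<T> \<alpha> s \<phi> \<noteq> 0}
             (\<lambda>s. (T s + delta_integral \<T> \<alpha> s \<psi>) / (T s + delta_integral \<T> \<alpha> s \<phi>)))
       \<and> (antimono_on ({\<alpha>..\<beta>} \<inter> \<T>) (\<lambda>t. \<psi> t / \<phi> t) \<and> \<psi> \<alpha> / \<phi> \<alpha> \<le> 1 \<longrightarrow>
           antimono_on {s \<in> {\<alpha>..\<beta>} \<inter> \<T>. T s + delta_integral \<T> \<alpha> s \<phi> \<noteq> 0}
             (\<lambda>s. (T s + delta_integral \<T> \<alpha> s \<psi>) / (T s + delta_integral \<T> \<alpha> s \<phi>)))"
  using assms delta_integral_quotient_mono[of \<alpha> \<T> \<beta> \<psi> \<phi> T]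
    delta_integral_quotient_antimono[of \<alpha> \<T> \<beta> \<psi> \<phi> T]
  by simp

end
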